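(* Let $\mathbf v\in\mathbb R^d$, $\psi>0$, and let $\mathbf z^*$ be the optimal solution of $$\min_{\mathbf z\in\mathbb R^d}\ \frac12\|\mathbf z-\mathbf v\|_2^2\quad\text{s.t.}\quad\|\mathbf z\|_1\le\psi.$$ If $\|\mathbf v\|_1\le\psi$, then $\mathbf z^*=\mathbf v$. Otherwise, let $i_1,\dots,i_d$ be a permutation of $\{1,\dots,d\}$ with $|\mathbf v_{i_1}|\ge|\mathbf v_{i_2}|\ge\dots\ge|\mathbf v_{i_d}|$, and let $s_0=0$, $s_d=\|\mathbf v\|_1$ and $s_m=\sum_{t=1}^m|\mathbf v_{i_t}|-m|\mathbf v_{i_{m+1}}|$ for $m=1,\dots,d-1$. Then $(s_m)_{m=0}^d$ is non-decreasing. If $s_{\bar m-1}<\psi\le s_{\bar m}$ for some $\bar m\in\{1,\dots,d\}$, then $$\mathbf z^*_{i_t}=\begin{cases}0,&\bar m<t\le d,\\[2pt]\mathbf v_{i_t}-\dfrac{\mathrm{sgn}(\mathbf v_{i_t})}{\bar m}\left(\displaystyle\sum_{k=1}^{\bar m}|\mathbf v_{i_k}|-\psi\right),&1\le t\le\bar m.\end{cases}$$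
   Context: $\mathbf v_i$ denotes the $i$-th component of $\mathbf v$; $\mathrm{sgn}(\alpha)=1,-1,0$ for $\alpha>0$, $\alpha<0$, $\alpha=0$ respectively. *)

theory Defs
  imports "HOL-Analysis.Analysis"
begin

definition l1_norm :: "real ^ 'n \<Rightarrow> real" where
  "l1_norm v = (\<Sum>j\<in>UNIV. \<bar>v $ j\<bar>)"

text \<open>An ordering of the coordinates is a bijection \<open>i\<close> from \<open>{1..d}\<close>, where \<open>d = CARD('n)\<close>,
  onto the index type. The following sequence is only meaningful for \<open>m \<le> d\<close>; the last branch
  is the case \<open>1 \<le> m \<le> d - 1\<close>.\<close>

definition breakpoint :: "real ^ 'n \<Rightarrow> (nat \<Rightarrow> 'n) \<Rightarrow> nat \<Rightarrow> real" where
  "breakpoint v i m =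
     (if m = 0 then 0
      else if m = CARD('n) then l1_norm v
      else (\<Sum>t=1..m. \<bar>v $ i t\<bar>) - real m * \<bar>v $ i (m + 1)\<bar>)"

end

theory Submission
  imports Defs
begin

text \<open>The minimizer is the soft thresholding of \<open>v\<close> at level
  \<open>\<theta> = (\<bar>v $ i 1\<bar> + \<dots> + \<bar>v $ i m\<bar> - \<psi>) / m\<close>. The two breakpoint inequalities say that \<open>\<theta>\<close> lies
  between the entries \<open>m + 1\<close> and \<open>m\<close> of the sorted list of absolute values, so thresholding kills
  exactly the entries after \<open>m\<close> and leaves \<open>l1\<close> norm \<open>\<psi>\<close>. Optimality and uniqueness come from the
  KKT conditions with multiplier \<open>\<theta>\<close>, which make the angle at \<open>w\<close> between \<open>v - w\<close> and any feasible
  direction obtuse.\<close>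

definition soft_threshold :: "real \<Rightarrow> real ^ 'n \<Rightarrow> real ^ 'n" where
  "soft_threshold \<theta> v = (\<chi> j. if \<bar>v $ j\<bar> \<le> \<theta> then 0 else v $ j - sgn (v $ j) * \<theta>)"

lemma soft_threshold_0: "soft_threshold 0 v = v"
  by (simp add: soft_threshold_def vec_eq_iff)

text \<open>Expanding the square about \<open>w\<close>, the obtuse angle makes the cross term
  nonnegative, so a feasible point is at least \<open>(norm (z - w))\<^sup>2\<close> worse than
  \<open>w\<close>.\<close>

lemma arg_min_dist_unique:
  fixes v w z\<^sub>0 :: "'a::real_inner"
  assumes opt: "is_arg_min (\<lambda>z. 1/2 * (norm (z - v))\<^sup>2) P z\<^sub>0"
    and "P w" and obtuse: "\<And>z. P z \<Longrightarrow> (v - w) \<bullet> (z - w) \<le> 0"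
  shows "z\<^sub>0 = w"
proof -
  have "P z\<^sub>0" and "(norm (z\<^sub>0 - v))\<^sup>2 \<le> (norm (w - v))\<^sup>2"
    using opt \<open>P w\<close> by (auto simp: is_arg_min_def not_less)
  moreover have "(norm (z\<^sub>0 - v))\<^sup>2
      = (norm (z\<^sub>0 - w))\<^sup>2 + (norm (w - v))\<^sup>2 - 2 * ((v - w) \<bullet> (z\<^sub>0 - w))"
    by (simp add: power2_norm_eq_inner inner_diff_left inner_diff_right inner_commute)
  ultimately have "(norm (z\<^sub>0 - w))\<^sup>2 \<le> 0"
    using obtuse[of z\<^sub>0] by linarith
  then show ?thesis by simp
qed

text \<open>Hoelder's inequality for the sup norm and the l1 norm.\<close>

lemma inner_le_bound_l1_norm:
  fixes u z :: "real ^ 'n"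
  assumes "\<And>j. \<bar>u $ j\<bar> \<le> \<theta>"
  shows "u \<bullet> z \<le> \<theta> * l1_norm z"
  unfolding inner_vec_def l1_norm_def sum_distrib_left
proof (rule sum_mono)
  fix j
  have "(u $ j) \<bullet> (z $ j) \<le> \<bar>u $ j\<bar> * \<bar>z $ j\<bar>"
    by (simp flip: abs_mult)
  also have "\<dots> \<le> \<theta> * \<bar>z $ j\<bar>"
    by (intro mult_right_mono assms) simp
  finally show "(u $ j) \<bullet> (z $ j) \<le> \<theta> * \<bar>z $ j\<bar>" .
qed

text \<open>The equality case of the Hoelder bound: where the thresholded entry is nonzero, it keeps
  the sign of \<open>v $ j\<close> and the residual is exactly
  \<open>sgn (v $ j) * \<theta>\<close>.\<close>

lemma inner_residual_soft_threshold:
  assumes "\<theta> \<ge> 0"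
  shows "(v - soft_threshold \<theta> v) \<bullet> soft_threshold \<theta> v = \<theta> * l1_norm (soft_threshold \<theta> v)"
  unfolding inner_vec_def l1_norm_def sum_distrib_left
  by (rule sum.cong) (use assms in \<open>auto simp: soft_threshold_def sgn_if abs_if split: if_splits\<close>)

lemma residual_soft_threshold_bound:
  assumes "\<theta> \<ge> 0"
  shows "\<bar>(v - soft_threshold \<theta> v) $ j\<bar> \<le> \<theta>"
  using assms by (auto simp: soft_threshold_def sgn_if)

text \<open>The condition \<open>\<theta> * l1_norm w = \<theta> * \<psi>\<close> is complementary slackness; \<open>\<theta> = 0\<close> covers the case
  of an inactive constraint.\<close>

lemma l1_ball_projection_eq_soft_threshold:
  fixes v z_opt :: "real ^ 'n"
  assumes opt: "is_arg_min (\<lambda>z. 1/2 * (norm (z - v))\<^sup>2) (\<lambda>z. l1_norm z \<le> \<psi>) z_opt"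
    and "\<theta> \<ge> 0" and "l1_norm (soft_threshold \<theta> v) \<le> \<psi>"
    and slack: "\<theta> * l1_norm (soft_threshold \<theta> v) = \<theta> * \<psi>"
  shows "z_opt = soft_threshold \<theta> v"
proof (rule arg_min_dist_unique[OF opt])
  fix z :: "real ^ 'n"
  assume "l1_norm z \<le> \<psi>"
  have "(v - soft_threshold \<theta> v) \<bullet> z \<le> \<theta> * l1_norm z"
    by (intro inner_le_bound_l1_norm residual_soft_threshold_bound \<open>\<theta> \<ge> 0\<close>)
  also have "\<dots> \<le> \<theta> * \<psi>"
    using \<open>l1_norm z \<le> \<psi>\<close> \<open>\<theta> \<ge> 0\<close> by (rule mult_left_mono)
  finally show "(v - soft_threshold \<theta> v) \<bullet> (z - soft_threshold \<theta> v) \<le> 0"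
    by (simp add: inner_diff_right inner_residual_soft_threshold[OF \<open>\<theta> \<ge> 0\<close>] slack
        del: mult_cancel_left)
qed fact

text \<open>Extending the sorted absolute values by \<open>0\<close> beyond \<open>d\<close> makes one formula cover all three
  branches of \<^const>\<open>breakpoint\<close>.\<close>

definition sorted_abs :: "real ^ 'n \<Rightarrow> (nat \<Rightarrow> 'n) \<Rightarrow> nat \<Rightarrow> real" where
  "sorted_abs v i t = (if t \<le> CARD('n) then \<bar>v $ i t\<bar> else 0)"

lemma sum_UNIV_reindex:
  fixes i :: "nat \<Rightarrow> 'n::finite"
  assumes "bij_betw i {1..CARD('n)} UNIV"
  shows "(\<Sum>j\<in>UNIV. f j) = (\<Sum>t=1..CARD('n). f (i t))"
  using sum.reindex_bij_betw[OF assms, of f] by simp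

lemma breakpoint_eq_sum:
  fixes v :: "real ^ 'n"
  assumes "bij_betw i {1..CARD('n)} UNIV" and "m \<le> CARD('n)"
  shows "breakpoint v i m = (\<Sum>t=1..m. sorted_abs v i t - sorted_abs v i (Suc m))"
proof -
  have "(\<Sum>t=1..m. sorted_abs v i t) = (\<Sum>t=1..m. \<bar>v $ i t\<bar>)"
    by (rule sum.cong) (use assms(2) in \<open>auto simp: sorted_abs_def\<close>)
  then show ?thesis
    using assms by (auto simp: breakpoint_def l1_norm_def sum_UNIV_reindex sum_subtractf sorted_abs_def)
qed

lemma sorted_abs_antimono:
  fixes v :: "real ^ 'n"
  assumes "antimono_on {1..CARD('n)} (\<lambda>t. \<bar>v $ i t\<bar>)" and "1 \<le> s" and "s \<le> t"
  shows "sorted_abs v i t \<le> sorted_abs v i s"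
  using monotone_onD[OF assms(1), of s t] assms(2,3) by (auto simp: sorted_abs_def)

text \<open>Raising \<open>m\<close> lowers the subtracted entry, which enlarges each old summand,
  and the new summands are nonnegative by the ordering.\<close>

lemma mono_breakpoint:
  fixes v :: "real ^ 'n"
  assumes bij: "bij_betw i {1..CARD('n)} UNIV"
    and anti: "antimono_on {1..CARD('n)} (\<lambda>t. \<bar>v $ i t\<bar>)"
  shows "mono_on {0..CARD('n)} (breakpoint v i)"
proof (rule mono_onI)
  fix m n assume *: "m \<in> {0..CARD('n)}" "n \<in> {0..CARD('n)}" "m \<le> n"
  let ?a = "sorted_abs v i"
  have "(\<Sum>t=1..m. ?a t - ?a (Suc m)) \<le> (\<Sum>t=1..m. ?a t - ?a (Suc n))"
    using *(3) by (intro sum_mono diff_left_mono sorted_abs_antimono[OF anti]) auto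
  also have "\<dots> \<le> (\<Sum>t=1..n. ?a t - ?a (Suc n))"
    using *(3) by (intro sum_mono2) (auto intro!: sorted_abs_antimono[OF anti])
  finally show "breakpoint v i m \<le> breakpoint v i n"
    using * by (simp add: breakpoint_eq_sum[OF bij])
qed

lemma breakpoint_threshold:
  fixes v :: "real ^ 'n"
  assumes bij: "bij_betw i {1..CARD('n)} UNIV"
    and m: "m \<in> {1..CARD('n)}"
    and bp: "breakpoint v i (m - 1) < \<psi>" "\<psi> \<le> breakpoint v i m"
  defines "\<theta> \<equiv> ((\<Sum>k=1..m. \<bar>v $ i k\<bar>) - \<psi>) / real m"
  shows "sorted_abs v i (Suc m) \<le> \<theta>" and "\<theta> < sorted_abs v i m"
proof -
  have sum_eq: "(\<Sum>t=1..m. sorted_abs v i t) = (\<Sum>t=1..m. \<bar>v $ i t\<bar>)"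
    by (rule sum.cong) (use m in \<open>auto simp: sorted_abs_def\<close>)
  have "\<psi> \<le> (\<Sum>t=1..m. \<bar>v $ i t\<bar>) - m * sorted_abs v i (Suc m)"
    using bp(2) m unfolding sum_eq[symmetric]
    by (simp add: breakpoint_eq_sum[OF bij] sum_subtractf)
  then show "sorted_abs v i (Suc m) \<le> \<theta>"
    using m by (simp add: \<theta>_def field_simps)
  obtain k where k: "m = Suc k"
    using m by (cases m) auto
  \<comment> \<open>The left side is \<open>breakpoint v i (m - 1)\<close>: its sum can be extended
    to \<open>t = m\<close>, because that summand is \<open>0\<close>.\<close>
  have "(\<Sum>t=1..m. \<bar>v $ i t\<bar>) - m * sorted_abs v i m < \<psi>"
    using bp(1) m unfolding sum_eq[symmetric]
    by (simp add: k breakpoint_eq_sum[OF bij] sum_subtractf algebra_simps)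
  then show "\<theta> < sorted_abs v i m"
    using m by (simp add: \<theta>_def field_simps)
qed

theorem lemma10:
  fixes v z_opt :: "real ^ 'n" and \<psi> :: real
  assumes "\<psi> > 0"
    and "is_arg_min (\<lambda>z. 1/2 * (norm (z - v))\<^sup>2) (\<lambda>z. l1_norm z \<le> \<psi>) z_opt"
  shows "(l1_norm v \<le> \<psi> \<longrightarrow> z_opt = v) \<and>
    (\<not> l1_norm v \<le> \<psi> \<longrightarrow>
      (\<forall>i :: nat \<Rightarrow> 'n.
        bij_betw i {1..CARD('n)} UNIV \<and> antimono_on {1..CARD('n)} (\<lambda>t. \<bar>v $ i t\<bar>) \<longrightarrow>
        mono_on {0..CARD('n)} (breakpoint v i) \<and>
        (\<forall>m\<in>{1..CARD('n)}.
          breakpoint v i (m - 1) < \<psi> \<and> \<psi> \<le> breakpoint v i m \<longrightarrow>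
          (\<forall>t\<in>{1..CARD('n)}.
            z_opt $ i t =
              (if m < t then 0
               else v $ i t - sgn (v $ i t) / real m * ((\<Sum>k=1..m. \<bar>v $ i k\<bar>) - \<psi>))))))"
proof (intro conjI impI allI ballI; (elim conjE)?)
  assume "l1_norm v \<le> \<psi>"
  then show "z_opt = v"
    using l1_ball_projection_eq_soft_threshold[OF assms(2), of 0] by (simp add: soft_threshold_0)
next
  fix i :: "nat \<Rightarrow> 'n"
  assume "bij_betw i {1..CARD('n)} UNIV" "antimono_on {1..CARD('n)} (\<lambda>t. \<bar>v $ i t\<bar>)"
  then show "mono_on {0..CARD('n)} (breakpoint v i)"
    by (rule mono_breakpoint)
next
  fix i :: "nat \<Rightarrow> 'n" and m t
  assume bij: "bij_betw i {1..CARD('n)} UNIV"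
    and anti: "antimono_on {1..CARD('n)} (\<lambda>t. \<bar>v $ i t\<bar>)"
    and m: "m \<in> {1..CARD('n)}"
    and bp: "breakpoint v i (m - 1) < \<psi>" "\<psi> \<le> breakpoint v i m"
    and t: "t \<in> {1..CARD('n)}"
  \<comment> \<open>The level at which the \<open>m\<close> largest absolute values, each lowered by
    \<open>\<theta>\<close>, sum to \<open>\<psi>\<close>.\<close>
  define \<theta> where "\<theta> = ((\<Sum>k=1..m. \<bar>v $ i k\<bar>) - \<psi>) / real m"
  note \<theta> = breakpoint_threshold[OF bij m bp, folded \<theta>_def]
  \<comment> \<open>For \<open>m = CARD('n)\<close> this is the padding value \<open>0\<close>, so
    the multiplier is nonnegative in that case too.\<close>
  have "0 \<le> sorted_abs v i (Suc m)"
    by (simp add: sorted_abs_def)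
  then have "\<theta> \<ge> 0"
    using \<theta>(1) by linarith
  \<comment> \<open>The strict bound \<open>\<theta> < sorted_abs v i m\<close> rules out a tie
    between entries \<open>m\<close> and \<open>m + 1\<close>, so the cut at \<open>\<theta>\<close>
    is the cut at position \<open>m\<close>.\<close>
  have threshold: "\<bar>v $ i t\<bar> \<le> \<theta> \<longleftrightarrow> m < t" if "t \<in> {1..CARD('n)}" for t
    using \<theta> that m sorted_abs_antimono[OF anti, of t m] sorted_abs_antimono[OF anti, of "Suc m" t]
    by (cases "m < t") (auto simp: sorted_abs_def split: if_splits)
  have w: "soft_threshold \<theta> v $ i t = (if m < t then 0 else v $ i t - sgn (v $ i t) * \<theta>)"
    if "t \<in> {1..CARD('n)}" for t
    using threshold[OF that] by (simp add: soft_threshold_def)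
  have abs_w: "\<bar>soft_threshold \<theta> v $ i t\<bar> = (if m < t then 0 else \<bar>v $ i t\<bar> - \<theta>)"
    if "t \<in> {1..CARD('n)}" for t
    using threshold[OF that] \<open>\<theta> \<ge> 0\<close> unfolding w[OF that] by (auto simp: sgn_if)
  have "l1_norm (soft_threshold \<theta> v) = (\<Sum>t=1..CARD('n). if m < t then 0 else \<bar>v $ i t\<bar> - \<theta>)"
    unfolding l1_norm_def sum_UNIV_reindex[OF bij] by (intro sum.cong abs_w refl)
  also have "\<dots> = (\<Sum>t=1..m. \<bar>v $ i t\<bar> - \<theta>)"
    using m by (intro sum.mono_neutral_cong_right) auto
  also have "\<dots> = \<psi>"
    using m by (simp add: sum_subtractf \<theta>_def)
  finally have "z_opt = soft_threshold \<theta> v"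
    using l1_ball_projection_eq_soft_threshold[OF assms(2) \<open>\<theta> \<ge> 0\<close>] by simp
  then show "z_opt $ i t = (if m < t then 0
      else v $ i t - sgn (v $ i t) / real m * ((\<Sum>k=1..m. \<bar>v $ i k\<bar>) - \<psi>))"
    using w[OF t] by (simp add: \<theta>_def)
qed

end
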